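(* Let $M$ be a planar map with vertex set $V$, $|V|=n$, and let $\alpha:V\to\mathbb{N}$ be any function. Then $M$ has at most $3.73^n$ $\alpha$-orientations.
   Context: A planar map is a finite simple planar graph together with a fixed crossing-free embedding in the Euclidean plane. $\mathbb{N}$ includes $0$. For a planar map $M$ with vertex set $V$ and a function $\alpha:V\to\mathbb{N}$, an $\alpha$-orientation of $M$ is an orientation of all edges of $M$ such that every vertex $v\in V$ has exactly $\alpha(v)$ edges directed away from it. *)

theory Defs
  imports "HOL-Analysis.Analysis"
begin

locale finite_simple_graph =
  fixes V :: "'a set" and E :: "'a set set"
  assumes finite_vertices: "finite V"
    and edges: "\<And>e. e \<in> E \<Longrightarrow> e \<subseteq> V \<and> card e = 2"
begin

lemma edge_distinct: "{u, v} \<in> E \<Longrightarrow> u \<noteq> v"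
  using edges by fastforce

lemma edge_vertices: "{u, v} \<in> E \<Longrightarrow> u \<in> V \<and> v \<in> V"
  using edges by blast

end

text \<open>
  The Euclidean plane is represented by \<^typ>\<open>complex\<close>. The vertex \<open>v\<close> is drawn as the point
  \<open>pos v\<close>, and the edge \<open>e\<close> as the Jordan arc \<open>\<gamma> e\<close>, whose parametrisation (in particular its
  direction) carries no combinatorial meaning. Arcs meet vertices only in their end points, and
  distinct arcs meet only in common end points.
\<close>

locale planar_map = finite_simple_graph V E
  for V :: "'a set" and E :: "'a set set" +
  fixes pos :: "'a \<Rightarrow> complex" and \<gamma> :: "'a set \<Rightarrow> real \<Rightarrow> complex"
  assumes inj_pos: "inj_on pos V"
    and edge_arc: "\<And>e. e \<in> E \<Longrightarrow> arc (\<gamma> e)"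
    and edge_ends: "\<And>e. e \<in> E \<Longrightarrow> {pathstart (\<gamma> e), pathfinish (\<gamma> e)} = pos ` e"
    and edge_avoids_vertices: "\<And>e. e \<in> E \<Longrightarrow> path_image (\<gamma> e) \<inter> pos ` V = pos ` e"
    and crossing_free:
      "\<And>e f. e \<in> E \<Longrightarrow> f \<in> E \<Longrightarrow> e \<noteq> f \<Longrightarrow>
         path_image (\<gamma> e) \<inter> path_image (\<gamma> f) \<subseteq> pos ` (e \<inter> f)"

text \<open>The pair \<open>(u, v)\<close> belongs to \<open>D\<close> iff the edge \<open>{u, v}\<close> is directed away from \<open>u\<close>.\<close>

definition orientation :: "'a set set \<Rightarrow> ('a \<times> 'a) set \<Rightarrow> bool" where
  "orientation E D \<longleftrightarrow>
     (\<forall>(u, v) \<in> D. {u, v} \<in> E) \<and>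
     (\<forall>u v. {u, v} \<in> E \<longrightarrow> ((u, v) \<in> D \<longleftrightarrow> (v, u) \<notin> D))"

definition outdegree :: "('a \<times> 'a) set \<Rightarrow> 'a \<Rightarrow> nat" where
  "outdegree D v = card {w. (v, w) \<in> D}"

definition alpha_orientations ::
  "'a set \<Rightarrow> 'a set set \<Rightarrow> ('a \<Rightarrow> nat) \<Rightarrow> ('a \<times> 'a) set set" where
  "alpha_orientations V E \<alpha> =
     {D. orientation E D \<and> (\<forall>v \<in> V. outdegree D v = \<alpha> v)}"

text \<open>
  Finiteness ensures that the cardinalities of these sets, which \<^const>\<open>card\<close> would otherwise
  set to 0, are the actual numbers of out-edges and of \<open>\<alpha>\<close>-orientations.
\<close>

context finite_simple_graph
begin

lemma orientation_subset: "orientation E D \<Longrightarrow> D \<subseteq> V \<times> V"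
  using edge_vertices by (fastforce simp: orientation_def)

lemma finite_out_neighbours:
  assumes "orientation E D"
  shows "finite {w. (v, w) \<in> D}"
  by (rule finite_subset[OF _ finite_vertices]) (use orientation_subset[OF assms] in blast)

lemma finite_alpha_orientations: "finite (alpha_orientations V E \<alpha>)"
proof (rule finite_subset)
  show "alpha_orientations V E \<alpha> \<subseteq> Pow (V \<times> V)"
    using orientation_subset by (auto simp: alpha_orientations_def)
  show "finite (Pow (V \<times> V))"
    using finite_vertices by simp
qed

end

end

theory Submission
  imports Defs
begin

text \<open>
  Order the vertices and reveal an \<open>\<alpha>\<close>-orientation vertex by vertex. When the edges to earlier
  vertices are already directed and \<open>b\<close> edges to later vertices remain, the number of these
  that leave the vertex is forced, so there are at most \<open>b choose (b div 2)\<close> choices. Hence the number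
  of \<open>\<alpha>\<close>-orientations is at most the product of these coefficients, while the \<open>b\<close> sum up
  to the number of edges, fewer than three per vertex in a planar graph.

  The values of \<open>b choose (b div 2)\<close> at 1, 2, 3, 4, 5 are 1, 2, 3, 6, 10, which
  is at most \<open>2 * (7/4) ^ (b - 2)\<close>. So if all \<open>b\<close> except the last are between 1 and 5, the product
  is at most \<open>2 * 7/4 = 3.5\<close> per vertex. Such an order exists for a connected planar
  graph: it always has a vertex of degree at most 5 that is not a cut vertex
  (\<open>low_degree_non_cut_vertex\<close>), and its deletion leaves a connected graph. This replaces
  the large independent set that the four colour theorem would provide. The only
  property of the graph that enters is that every nonempty set \<open>U\<close> of vertices spans at
  most \<open>3 * (card U - 1)\<close> edges (\<open>alpha_orientations_three_sparse\<close>).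

  That planar maps have this property (\<open>planar_edge_bound\<close>) is derived from the drawing by the usual
  double count of faces and edges. An edge added to a connected drawing creates a new face, by
  the Jordan curve theorem (\<open>chord_adds_a_face\<close>). Janiszewski's theorem shows that
  an edge borders at most two faces (\<open>edge_borders_two_faces\<close>) and that two edges of a
  simple graph do not separate the plane, so that a face borders at
  least three edges (\<open>face_borders_three_edges\<close>). Bridges, which would be an exception to some
  of these arguments, are avoided by splitting the graph along small cuts.
\<close>

section \<open>Connected and sparse graphs\<close>

definition induced :: "'a set set \<Rightarrow> 'a set \<Rightarrow> 'a set set" where
  "induced E U = {e \<in> E. e \<subseteq> U}"

text \<open>
  Connectedness is stated through cuts rather than walks: this form passes to the drawing and to
  vertex deletion without any manipulation of paths.
\<close>

definition connected_graph :: "'a set \<Rightarrow> 'a set set \<Rightarrow> bool" where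
  "connected_graph V E \<longleftrightarrow>
     (\<forall>U. U \<subseteq> V \<longrightarrow> U \<noteq> {} \<longrightarrow> U \<noteq> V \<longrightarrow> (\<exists>u\<in>U. \<exists>w\<in>V - U. {u, w} \<in> E))"

definition vertex_degree :: "'a set set \<Rightarrow> 'a \<Rightarrow> nat" where
  "vertex_degree E v = card {e \<in> E. v \<in> e}"

text \<open>
  The (3,3)-sparse graphs of rigidity theory, equivalently (by Nash-Williams) the unions of three
  forests. Planar graphs satisfy \<open>card E \<le> 3 * card V - 6\<close> only for three or more vertices; the weaker
  bound \<open>3 * (card V - 1)\<close> holds for all nonempty vertex sets and adds up over a partition of the
  vertices into two parts joined by at most three edges.
\<close>

definition three_sparse :: "'a set \<Rightarrow> 'a set set \<Rightarrow> bool" where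
  "three_sparse V E \<longleftrightarrow> (\<forall>U. U \<subseteq> V \<longrightarrow> U \<noteq> {} \<longrightarrow> card (induced E U) \<le> 3 * (card U - 1))"

lemma connected_graphD:
  assumes "connected_graph V E" "U \<subseteq> V" "U \<noteq> {}" "U \<noteq> V"
  shows "\<exists>u\<in>U. \<exists>w\<in>V - U. {u, w} \<in> E"
  using assms unfolding connected_graph_def by blast

lemma induced_induced: "W \<subseteq> U \<Longrightarrow> induced (induced E U) W = induced E W"
  by (auto simp: induced_def)

lemma three_sparse_induced: "three_sparse V E \<Longrightarrow> U \<subseteq> V \<Longrightarrow> three_sparse U (induced E U)"
  by (auto simp: three_sparse_def induced_induced)

context finite_simple_graph
begin

lemma finite_edges: "finite E"
  by (rule finite_subset[of _ "Pow V"]) (use edges finite_vertices in auto)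

lemma edge_as_pair:
  assumes "e \<in> E"
  obtains u v where "e = {u, v}" "u \<noteq> v" "u \<in> V" "v \<in> V"
  using edges[OF assms] unfolding card_2_iff by blast

lemma graph_induced: "U \<subseteq> V \<Longrightarrow> finite_simple_graph U (induced E U)"
  using finite_vertices edges by (unfold_locales) (auto simp: induced_def intro: finite_subset)

lemma sum_vertex_degree: "(\<Sum>v\<in>V. vertex_degree E v) = 2 * card E"
proof -
  have "(\<Sum>v\<in>V. vertex_degree E v) = (\<Sum>v\<in>V. \<Sum>e\<in>E. if v \<in> e then 1 else 0)"
    unfolding vertex_degree_def using finite_edges by (simp add: sum.If_cases Int_def)
  also have "\<dots> = (\<Sum>e\<in>E. \<Sum>v\<in>V. if v \<in> e then 1 else 0)" by (rule sum.swap)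
  also have "\<dots> = (\<Sum>e\<in>E. 2)"
  proof (rule sum.cong[OF refl])
    fix e assume "e \<in> E"
    then have "V \<inter> e = e" "card e = 2" using edges by auto
    moreover have "(\<Sum>v\<in>V. if v \<in> e then 1 else 0) = card (V \<inter> e)"
      using finite_vertices by (simp add: sum.If_cases)
    ultimately show "(\<Sum>v\<in>V. if v \<in> e then 1 else 0) = (2::nat)" by simp
  qed
  finally show ?thesis by simp
qed

lemma vertex_degree_pos:
  assumes "connected_graph V E" "v \<in> V" "V \<noteq> {v}"
  shows "vertex_degree E v \<ge> 1"
proof -
  obtain w where "{v, w} \<in> E"
    using connected_graphD[OF assms(1), of "{v}"] assms(2,3) by auto
  then have "{e \<in> E. v \<in> e} \<noteq> {}" by blast
  then show ?thesis unfolding vertex_degree_def using finite_edges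
    by (simp add: Suc_le_eq card_gt_0_iff)
qed

lemma neighbours_card: "card {w. {v, w} \<in> E} = vertex_degree E v"
proof -
  have inj: "inj_on (\<lambda>w. {v, w}) {w. {v, w} \<in> E}" by (auto simp: inj_on_def doubleton_eq_iff)
  have "(\<lambda>w. {v, w}) ` {w. {v, w} \<in> E} = {e \<in> E. v \<in> e}"
  proof -
    have "e \<in> (\<lambda>w. {v, w}) ` {w. {v, w} \<in> E}" if e: "e \<in> E" "v \<in> e" for e
    proof -
      obtain a b where "e = {a, b}" using edge_as_pair[OF e(1)] by metis
      then show ?thesis using e by (auto simp: image_iff insert_commute)
    qed
    then show ?thesis by auto
  qed
  then show ?thesis unfolding vertex_degree_def using card_image[OF inj] by simp
qed

lemma no_edges:
  assumes "card V \<le> 1"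
  shows "E = {}"
proof (rule ccontr)
  assume "E \<noteq> {}"
  then obtain e where "e \<in> E" by blast
  then have "card e \<le> card V" "card e = 2" using edges card_mono[OF finite_vertices] by blast+
  then show False using assms by simp
qed

end

lemma connected_graph_mono: "connected_graph V F \<Longrightarrow> F \<subseteq> G \<Longrightarrow> connected_graph V G"
  unfolding connected_graph_def by blast

lemma connected_graph_insert:
  assumes "connected_graph U T" "u \<in> U" "w \<notin> U"
  shows "connected_graph (insert w U) (insert {u, w} T)"
  unfolding connected_graph_def
proof (intro allI impI)
  fix X assume X: "X \<subseteq> insert w U" "X \<noteq> {}" "X \<noteq> insert w U"
  show "\<exists>a\<in>X. \<exists>b\<in>insert w U - X. {a, b} \<in> insert {u, w} T"
  proof (cases "X \<inter> U = {} \<or> X \<inter> U = U")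
    case True
    then have "X = {w} \<or> X = U" using X by blast
    then show ?thesis using assms(2,3) by (auto simp: insert_commute)
  next
    case False
    then obtain a b where "a \<in> X \<inter> U" "b \<in> U - X \<inter> U" "{a, b} \<in> T"
      using connected_graphD[OF assms(1), of "X \<inter> U"] by blast
    then show ?thesis by blast
  qed
qed

text \<open>
  Grow a connected vertex set one vertex at a time, adding one edge that leaves it in each step.
\<close>

lemma spanning_tree:
  assumes "finite V" "V \<noteq> {}" "connected_graph V E"
  obtains T where "T \<subseteq> E" "finite T" "card T < card V" "connected_graph V T"
proof -
  have "\<exists>U T. U \<subseteq> V \<and> card U = Suc k \<and> T \<subseteq> E \<and> finite T \<and> card T \<le> k \<and> connected_graph U T"
    if "k < card V" for k
    using that
  proof (induction k)
    case 0
    obtain x where "x \<in> V" using assms(2) by blast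
    moreover have "connected_graph {x} {}" unfolding connected_graph_def by blast
    ultimately show ?case by (intro exI[of _ "{x}"] exI[of _ "{}"]) auto
  next
    case (Suc k)
    then obtain U T where UT: "U \<subseteq> V" "card U = Suc k" "T \<subseteq> E" "finite T" "card T \<le> k" "connected_graph U T"
      by auto
    then have "U \<noteq> V" "U \<noteq> {}" using Suc.prems by auto
    then obtain u w where uw: "u \<in> U" "w \<in> V - U" "{u, w} \<in> E"
      using connected_graphD[OF assms(3) UT(1)] by blast
    have "finite U" using UT(1) assms(1) finite_subset by blast
    then have "card (insert w U) = Suc (Suc k)" using uw UT by simp
    moreover have "card (insert {u, w} T) \<le> Suc k"
      using UT(4,5) card_insert_le_m1[of "Suc k" T] by simp
    ultimately show ?case
      using UT uw connected_graph_insert[OF UT(6) uw(1)]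
      by (intro exI[of _ "insert w U"] exI[of _ "insert {u, w} T"]) auto
  qed
  moreover have pos: "0 < card V" using assms by (simp add: card_gt_0_iff)
  ultimately obtain U T where UT: "U \<subseteq> V" "card U = card V" "T \<subseteq> E" "finite T"
      "card T \<le> card V - 1" "connected_graph U T"
    by (metis Suc_pred' diff_less zero_less_one)
  then have "U = V" using assms(1) card_subset_eq by blast
  then show ?thesis using that[of T] UT pos by auto
qed

section \<open>Non-cut vertices of low degree\<close>

context finite_simple_graph
begin

text \<open>
  A leaf block without blocks. Among all pairs of a vertex \<open>x\<close> and a nonempty set \<open>C\<close> of other
  vertices whose edges lead only to \<open>C\<close> and \<open>x\<close>, take one with \<open>C\<close> smallest. No vertex \<open>v\<close> of \<open>C\<close> is a
  cut vertex: otherwise a piece hanging off \<open>v\<close> and avoiding \<open>x\<close> would meet \<open>C\<close> in a smaller set of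
  the same kind.
\<close>

lemma end_piece:
  assumes conn: "connected_graph V E" and V: "card V \<ge> 2"
  obtains x C where "x \<in> V" "C \<subseteq> V - {x}" "C \<noteq> {}"
    "\<And>u w. {u, w} \<in> E \<Longrightarrow> u \<in> C \<Longrightarrow> w \<in> insert x C"
    "\<And>v. v \<in> C \<Longrightarrow> connected_graph (V - {v}) (induced E (V - {v}))"
proof -
  define piece where "piece x C \<longleftrightarrow> x \<in> V \<and> C \<subseteq> V - {x} \<and> C \<noteq> {} \<and>
      (\<forall>u w. {u, w} \<in> E \<longrightarrow> u \<in> C \<longrightarrow> w \<in> insert x C)" for x C
  obtain x0 where x0: "x0 \<in> V" using V by fastforce
  have "V - {x0} \<noteq> {}"
  proof
    assume "V - {x0} = {}"
    then have "V = {x0}" using x0 by blast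
    then show False using V by simp
  qed
  then have "piece x0 (V - {x0})"
    unfolding piece_def using x0 edge_vertices by blast
  then obtain x C where xC: "piece x C"
    and least: "\<And>y D. piece y D \<Longrightarrow> card C \<le> card D"
    using ex_has_least_nat[of "\<lambda>(x, C). piece x C" "(x0, V - {x0})" "\<lambda>(x, C). card C"]
    by fastforce
  have finC: "finite C" using xC finite_vertices unfolding piece_def
    by (meson finite_Diff finite_subset)
  have "connected_graph (V - {v}) (induced E (V - {v}))" if v: "v \<in> C" for v
  proof (rule ccontr)
    assume "\<not> ?thesis"
    then obtain U where U: "U \<subseteq> V - {v}" "U \<noteq> {}" "U \<noteq> V - {v}"
      and cut: "\<And>u w. u \<in> U \<Longrightarrow> w \<in> V - {v} - U \<Longrightarrow> {u, w} \<notin> E"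
      unfolding connected_graph_def induced_def by blast
    \<comment> \<open>Of the two sides of the cut, the one that avoids \<open>x\<close>.\<close>
    define U' where "U' = (if x \<in> U then V - {v} - U else U)"
    have U': "U' \<subseteq> V - {v}" "U' \<noteq> {}" "x \<notin> U'" using U unfolding U'_def by auto
    have cut': "w \<in> insert v U'" if "{u, w} \<in> E" "u \<in> U'" for u w
      using cut[of u w] cut[of w u] that U edge_vertices[of u w] unfolding U'_def
      by (auto simp: insert_commute split: if_splits)
    show False
    proof (cases "U' \<inter> C = {}")
      case True
      have "U' \<noteq> V" using U' xC unfolding piece_def by blast
      then obtain u w where uw: "u \<in> U'" "w \<in> V" "w \<notin> U'" "{u, w} \<in> E"
        using connected_graphD[OF conn, of U'] U' by auto
      then have "w = v" using cut' by blast
      then have "u \<in> insert x C" using uw(4) v xC unfolding piece_def by (metis insert_commute)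
      then show False using uw(1) True U' by blast
    next
      case False
      have "piece v (U' \<inter> C)"
        using xC v U' cut' False unfolding piece_def by blast
      moreover have "card (U' \<inter> C) < card C"
        by (rule psubset_card_mono[OF finC]) (use v U' in blast)
      ultimately show False using least by (meson not_less)
    qed
  qed
  then show ?thesis using that[of x C] xC unfolding piece_def by simp
qed

text \<open>
  The vertices of an end piece \<open>C\<close> attached at \<open>x\<close> are not cut vertices, and their edges stay inside
  \<open>insert x C\<close>. Sparsity bounds the degree sum over \<open>insert x C\<close> by \<open>6 * card C\<close>; the vertex \<open>x\<close> takes
  at least 1 of it, so the average over \<open>C\<close> is below 6.
\<close>

lemma low_degree_non_cut_vertex:
  assumes conn: "connected_graph V E" and sparse: "three_sparse V E" and V: "card V \<ge> 2"
  obtains v where "v \<in> V" "1 \<le> vertex_degree E v" "vertex_degree E v \<le> 5"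
    "connected_graph (V - {v}) (induced E (V - {v}))"
proof -
  obtain x C where x: "x \<in> V" and C: "C \<subseteq> V - {x}" "C \<noteq> {}"
    and out: "\<And>u w. {u, w} \<in> E \<Longrightarrow> u \<in> C \<Longrightarrow> w \<in> insert x C"
    and noncut: "\<And>v. v \<in> C \<Longrightarrow> connected_graph (V - {v}) (induced E (V - {v}))"
    using end_piece[OF conn V] by metis
  define W where "W = insert x C"
  have WV: "W \<subseteq> V" using x C W_def by blast
  interpret W: finite_simple_graph W "induced E W" by (rule graph_induced[OF WV])
  have finC: "finite C" using C finite_vertices by (meson finite_Diff finite_subset)
  have xC: "x \<notin> C" using C by blast
  have deg: "vertex_degree (induced E W) v = vertex_degree E v" if "v \<in> C" for v
  proof -
    have "e \<subseteq> W" if e: "e \<in> E" "v \<in> e" for e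
    proof -
      obtain a b where ab: "e = {a, b}" using edge_as_pair[OF e(1)] by metis
      then have "{a, b} \<in> E" "{b, a} \<in> E" "v = a \<or> v = b" using e by (auto simp: insert_commute)
      then show ?thesis using ab out[of a b] out[of b a] \<open>v \<in> C\<close> unfolding W_def by blast
    qed
    then have "{e \<in> induced E W. v \<in> e} = {e \<in> E. v \<in> e}" unfolding induced_def by blast
    then show ?thesis unfolding vertex_degree_def by simp
  qed
  have "vertex_degree (induced E W) x \<ge> 1"
  proof -
    have "C \<subseteq> V" "C \<noteq> V" using C(1) x by auto
    then obtain u w where uw: "u \<in> C" "w \<notin> C" "{u, w} \<in> E"
      using connected_graphD[OF conn _ C(2)] by auto
    then have "w = x" using out[OF uw(3,1)] by blast
    with uw have "{u, x} \<in> {e \<in> induced E W. x \<in> e}" unfolding induced_def W_def by blast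
    then have "{e \<in> induced E W. x \<in> e} \<noteq> {}" by blast
    then show ?thesis unfolding vertex_degree_def using W.finite_edges
      by (simp add: Suc_le_eq card_gt_0_iff)
  qed
  moreover have "vertex_degree (induced E W) x + (\<Sum>v\<in>C. vertex_degree E v) = 2 * card (induced E W)"
    using W.sum_vertex_degree finC xC deg unfolding W_def by simp
  moreover have "card (induced E W) \<le> 3 * card C"
    using sparse WV finC xC unfolding three_sparse_def W_def
    by (metis card_insert_disjoint diff_Suc_1 insert_not_empty)
  ultimately have "(\<Sum>v\<in>C. vertex_degree E v) < 6 * card C" by linarith
  then obtain v where v: "v \<in> C" "vertex_degree E v < 6"
    using sum_bounded_below[of C 6 "vertex_degree E"] by (force simp: not_less mult.commute)
  moreover have "v \<in> V" "V \<noteq> {v}" using v C V x by auto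
  ultimately show ?thesis using that[of v] noncut vertex_degree_pos[OF conn, of v] by auto
qed

end

section \<open>Counting orientations by vertex deletion\<close>

definition pairs_in :: "'a set \<Rightarrow> ('a \<times> 'a) set \<Rightarrow> ('a \<times> 'a) set" where
  "pairs_in U D = D \<inter> U \<times> U"

context finite_simple_graph
begin

lemma orientation_swap:
  assumes "orientation E D"
  shows "(w, v) \<in> D \<longleftrightarrow> {v, w} \<in> E \<and> (v, w) \<notin> D"
proof -
  have "{w, v} = {v, w}" by blast
  then show ?thesis using assms unfolding orientation_def by (metis (mono_tags, lifting) case_prodD)
qed

lemma orientation_induced: "orientation E D \<Longrightarrow> orientation (induced E U) (pairs_in U D)"
  unfolding orientation_def induced_def pairs_in_def by blast

lemma alpha_orientations_split:
  assumes U: "U \<subseteq> V" and cut: "\<And>u w. u \<in> U \<Longrightarrow> w \<in> V - U \<Longrightarrow> {u, w} \<notin> E"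
  shows "card (alpha_orientations V E \<alpha>) \<le>
    card (alpha_orientations U (induced E U) \<alpha>) * card (alpha_orientations (V - U) (induced E (V - U)) \<alpha>)"
proof -
  interpret U: finite_simple_graph U "induced E U" by (rule graph_induced[OF U])
  interpret W: finite_simple_graph "V - U" "induced E (V - U)" by (rule graph_induced) auto
  let ?f = "\<lambda>D. (pairs_in U D, pairs_in (V - U) D)"
  let ?A = "alpha_orientations U (induced E U) \<alpha>"
  let ?B = "alpha_orientations (V - U) (induced E (V - U)) \<alpha>"
  have side: "w \<in> U \<longleftrightarrow> v \<in> U" "v \<in> V" "w \<in> V" if "orientation E D" "(v, w) \<in> D" for D v w
  proof -
    have e: "{v, w} \<in> E" using that unfolding orientation_def by blast
    then show "v \<in> V" "w \<in> V" using edge_vertices by blast+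
    then show "w \<in> U \<longleftrightarrow> v \<in> U" using e cut[of v w] cut[of w v] by (auto simp: insert_commute)
  qed
  have "inj_on ?f (alpha_orientations V E \<alpha>)"
  proof (rule inj_onI)
    fix D D' assume "D \<in> alpha_orientations V E \<alpha>" "D' \<in> alpha_orientations V E \<alpha>" "?f D = ?f D'"
    moreover have "D = pairs_in U D \<union> pairs_in (V - U) D" if "D \<in> alpha_orientations V E \<alpha>" for D
      using that side unfolding alpha_orientations_def pairs_in_def by fast
    ultimately show "D = D'" by (metis prod.inject)
  qed
  moreover have "?f ` alpha_orientations V E \<alpha> \<subseteq> ?A \<times> ?B"
  proof (rule image_subsetI)
    fix D assume D: "D \<in> alpha_orientations V E \<alpha>"
    then have o: "orientation E D" unfolding alpha_orientations_def by simp
    have "{w. (v, w) \<in> pairs_in U D} = {w. (v, w) \<in> D}" if "v \<in> U" for v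
      using side[OF o] that unfolding pairs_in_def by blast
    moreover have "{w. (v, w) \<in> pairs_in (V - U) D} = {w. (v, w) \<in> D}" if "v \<in> V - U" for v
      using side[OF o] that unfolding pairs_in_def by blast
    ultimately show "?f D \<in> ?A \<times> ?B"
      using D U orientation_induced[OF o] unfolding alpha_orientations_def outdegree_def by auto
  qed
  moreover have "finite (?A \<times> ?B)"
    using U.finite_alpha_orientations W.finite_alpha_orientations by simp
  ultimately have "card (alpha_orientations V E \<alpha>) \<le> card (?A \<times> ?B)"
    by (rule card_inj_on_le)
  then show ?thesis by (simp add: card_cartesian_product)
qed

text \<open>
  An \<open>\<alpha>\<close>-orientation is determined by the set of \<open>\<alpha> v\<close> out-neighbours of \<open>v\<close> and by its restriction to
  the other vertices, which has prescribed outdegrees again once the out-neighbours of \<open>v\<close> are known.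
\<close>

lemma alpha_orientations_delete_vertex:
  assumes v: "v \<in> V"
    and bound: "\<And>\<beta>. card (alpha_orientations (V - {v}) (induced E (V - {v})) \<beta>) \<le> M"
  shows "card (alpha_orientations V E \<alpha>) \<le> (vertex_degree E v choose \<alpha> v) * M"
proof -
  let ?N = "{w. {v, w} \<in> E}" and ?E' = "induced E (V - {v})"
  interpret W: finite_simple_graph "V - {v}" ?E' by (rule graph_induced) auto
  define out where "out D = {w. (v, w) \<in> D}" for D :: "('a \<times> 'a) set"
  \<comment> \<open>The outdegrees left to the other vertices when exactly the edges from \<open>v\<close> to \<open>S\<close> leave \<open>v\<close>.\<close>
  define \<beta> where "\<beta> S w = \<alpha> w - (if w \<in> ?N - S then 1 else 0)" for S w
  let ?S = "{S. S \<subseteq> ?N \<and> card S = \<alpha> v}"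
  let ?f = "\<lambda>D. (out D, pairs_in (V - {v}) D)"
  let ?T = "Sigma ?S (\<lambda>S. alpha_orientations (V - {v}) ?E' (\<beta> S))"
  have finN: "finite ?N" by (rule finite_subset[OF _ finite_vertices]) (use edge_vertices in blast)
  have finS: "finite ?S" by (rule finite_subset[of _ "Pow ?N"]) (use finN in auto)
  have "inj_on ?f (alpha_orientations V E \<alpha>)"
  proof (rule inj_onI)
    fix D D' assume DD': "D \<in> alpha_orientations V E \<alpha>" "D' \<in> alpha_orientations V E \<alpha>" "?f D = ?f D'"
    have "D = {v} \<times> out D \<union> {(w, v) | w. w \<in> ?N - out D} \<union> pairs_in (V - {v}) D"
      if "D \<in> alpha_orientations V E \<alpha>" for D
    proof -
      have o: "orientation E D" using that unfolding alpha_orientations_def by simp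
      have "(w, v) \<in> D \<longleftrightarrow> {v, w} \<in> E \<and> (v, w) \<notin> D" for w
        by (rule orientation_swap[OF o])
      then show ?thesis using orientation_subset[OF o] v unfolding out_def pairs_in_def by blast
    qed
    from this[OF DD'(1)] this[OF DD'(2)] DD'(3) show "D = D'" by simp
  qed
  moreover have "?f ` alpha_orientations V E \<alpha> \<subseteq> ?T"
  proof (rule image_subsetI)
    fix D assume D: "D \<in> alpha_orientations V E \<alpha>"
    then have o: "orientation E D" unfolding alpha_orientations_def by simp
    have outN: "out D \<subseteq> ?N" "card (out D) = \<alpha> v"
      using D v o unfolding out_def alpha_orientations_def outdegree_def orientation_def by auto
    have "outdegree (pairs_in (V - {v}) D) w = \<beta> (out D) w" if w: "w \<in> V - {v}" for w
    proof -
      have into: "(w, v) \<in> D \<longleftrightarrow> w \<in> ?N - out D"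
        unfolding orientation_swap[OF o, of w v] out_def by blast
      have "{x. (w, x) \<in> pairs_in (V - {v}) D} = {x. (w, x) \<in> D} - {v}"
        using w orientation_subset[OF o] unfolding pairs_in_def by blast
      moreover have "card {x. (w, x) \<in> D} = \<alpha> w"
        using D w unfolding alpha_orientations_def outdegree_def by auto
      ultimately show ?thesis
        using into unfolding outdegree_def \<beta>_def by (simp add: card_Diff_singleton_if)
    qed
    then show "?f D \<in> ?T"
      using outN orientation_induced[OF o] unfolding alpha_orientations_def by auto
  qed
  moreover have "finite ?T" using finS W.finite_alpha_orientations by blast
  ultimately have "card (alpha_orientations V E \<alpha>) \<le> card ?T" by (rule card_inj_on_le)
  also have "\<dots> = (\<Sum>S\<in>?S. card (alpha_orientations (V - {v}) ?E' (\<beta> S)))"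
    by (rule card_SigmaI) (use finS W.finite_alpha_orientations in auto)
  also have "\<dots> \<le> card ?S * M"
    using sum_bounded_above[of ?S _ M] bound by (metis (no_types, lifting) of_nat_id)
  also have "card ?S = vertex_degree E v choose \<alpha> v"
    using n_subsets[OF finN] neighbours_card by simp
  finally show ?thesis .
qed

end

lemma alpha_orientations_edgeless: "card (alpha_orientations V {} \<alpha>) \<le> 1"
proof -
  have "alpha_orientations V {} \<alpha> \<subseteq> {{}}"
    unfolding alpha_orientations_def orientation_def by auto
  then show ?thesis using card_mono[of "{{}}" "alpha_orientations V {} \<alpha>"] by simp
qed

text \<open>
  The sequence 1, 2, 3, 6, 10 of largest binomial coefficients lies below the geometric
  sequence \<open>2 * (7/4) ^ (d - 2)\<close> for \<open>d = 1, \<dots>, 5\<close>, with equality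
  at \<open>d = 2\<close>. The value of the geometric sequence at 3, which is 3.5, is the growth rate obtained in
  the end, since there are at most three edges per vertex on average.
\<close>

lemma choose_le_weight:
  assumes "1 \<le> d" "d \<le> (5::nat)"
  shows "real (d choose k) * (7/4)^2 \<le> 2 * (7/4)^d"
proof -
  have "(2::nat) choose 1 = 2" "(3::nat) choose 1 = 3" "(4::nat) choose 2 = 6" "(5::nat) choose 2 = 10"
    by (simp_all add: choose_two)
  moreover have "d = 1 \<or> d = 2 \<or> d = 3 \<or> d = 4 \<or> d = 5" using assms by auto
  ultimately have "real (d choose (d div 2)) * (7/4)^2 \<le> 2 * (7/4)^d"
    by (elim disjE) (simp_all add: power_divide)
  moreover have "real (d choose k) \<le> real (d choose (d div 2))"
    using binomial_maximum[of d k] by simp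
  ultimately show ?thesis by (smt (verit) mult_right_mono zero_le_power2)
qed

text \<open>
  Delete non-cut vertices of degree between 1 and 5 until one vertex is left. Deleting one of
  degree \<open>d\<close> costs a factor \<open>2 * (7/4) ^ d / (7/4) ^ 2\<close>, and the degrees met on the way add up to \<open>card E\<close>.
  Connectedness is what excludes degree 0, for which this factor would be below 1.
\<close>

lemma alpha_orientations_connected:
  assumes "finite_simple_graph V E" "connected_graph V E" "three_sparse V E" "V \<noteq> {}"
  shows "real (card (alpha_orientations V E \<alpha>)) * (7/4)^(2 * (card V - 1))
           \<le> 2^(card V - 1) * (7/4)^card E"
  using assms
proof (induction "card V" arbitrary: V E \<alpha> rule: less_induct)
  case less
  interpret finite_simple_graph V E by fact
  have fin: "finite V" by (rule finite_vertices)
  show ?case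
  proof (cases "card V \<ge> 2")
    case False
    then have "card V - 1 = 0" "E = {}" using no_edges by simp_all
    then show ?thesis using alpha_orientations_edgeless[of V \<alpha>] by simp
  next
    case True
    obtain v where v: "v \<in> V" "1 \<le> vertex_degree E v" "vertex_degree E v \<le> 5"
      and conn: "connected_graph (V - {v}) (induced E (V - {v}))"
      using low_degree_non_cut_vertex[OF less.prems(2,3) True] by metis
    let ?E' = "induced E (V - {v})" and ?d = "vertex_degree E v"
    have V': "V - {v} \<noteq> {}"
    proof
      assume "V - {v} = {}"
      then have "V = {v}" using v by blast
      then show False using True by simp
    qed
    have cV: "card V = Suc (card (V - {v}))" using fin v by (metis card_Suc_Diff1)
    have pos: "card (V - {v}) \<ge> 1" using V' fin by (simp add: Suc_le_eq card_gt_0_iff)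
    have split: "E = ?E' \<union> {e \<in> E. v \<in> e}" "?E' \<inter> {e \<in> E. v \<in> e} = {}"
      using edges unfolding induced_def by blast+
    have cE: "card E = card ?E' + ?d"
      using card_Un_disjoint[OF _ _ split(2)] finite_edges split(1) unfolding vertex_degree_def
      by (metis finite_Un)
    let ?k = "card (V - {v}) - 1"
    have IH: "real (card (alpha_orientations (V - {v}) ?E' \<beta>)) * (7/4)^(2 * ?k)
        \<le> 2^?k * (7/4)^card ?E'" for \<beta>
      using less.hyps[of "V - {v}" ?E' \<beta>] cV graph_induced[of "V - {v}"] conn V'
        three_sparse_induced[OF less.prems(3), of "V - {v}"] by auto
    define X :: real where "X = 2^?k * (7/4)^card ?E' / (7/4)^(2 * ?k)"
    have X: "real (card (alpha_orientations (V - {v}) ?E' \<beta>)) \<le> X" for \<beta>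
      using IH[of \<beta>] unfolding X_def by (simp add: pos_le_divide_eq)
    \<comment> \<open>Deletion needs an integer bound, so the real bound \<open>X\<close> is rounded down.\<close>
    have "card (alpha_orientations V E \<alpha>) \<le> (?d choose \<alpha> v) * nat \<lfloor>X\<rfloor>"
      by (rule alpha_orientations_delete_vertex[OF v(1)]) (use X in \<open>simp add: le_nat_floor\<close>)
    then have "real (card (alpha_orientations V E \<alpha>)) \<le> real (?d choose \<alpha> v) * real (nat \<lfloor>X\<rfloor>)"
      by (metis of_nat_le_iff of_nat_mult)
    also have "\<dots> \<le> real (?d choose \<alpha> v) * X"
      by (intro mult_left_mono) (simp_all add: X_def)
    finally have *: "real (card (alpha_orientations V E \<alpha>)) \<le> real (?d choose \<alpha> v) * X" .
    have e2: "2 * (card V - 1) = 2 + 2 * ?k" using cV pos by simp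
    have "real (card (alpha_orientations V E \<alpha>)) * (7/4)^(2 * (card V - 1))
        \<le> real (?d choose \<alpha> v) * X * (7/4)^(2 * (card V - 1))"
      using * by (intro mult_right_mono) simp_all
    also have "\<dots> = (real (?d choose \<alpha> v) * (7/4)^2) * (X * (7/4)^(2 * ?k))"
      unfolding e2 power_add by (simp only: mult_ac)
    also have "X * (7/4)^(2 * ?k) = 2^?k * (7/4)^card ?E'" unfolding X_def by simp
    also have "(real (?d choose \<alpha> v) * (7/4)^2) * (2^?k * (7/4)^card ?E')
        \<le> (2 * (7/4)^?d) * (2^?k * (7/4)^card ?E')"
      by (intro mult_right_mono choose_le_weight v) simp
    also have "\<dots> = 2^(card V - 1) * (7/4)^card E"
    proof -
      have "card V - 1 = Suc ?k" using cV pos by simp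
      then show ?thesis unfolding cE power_add power_Suc by (simp only: power_Suc mult_ac)
    qed
    finally show ?thesis .
  qed
qed

text \<open>
  With \<open>card E \<le> 3 * (card V - 1)\<close> the weighted bound for connected graphs
  becomes \<open>(2 * 7/4) ^ (card V - 1)\<close>, and the count is multiplicative over the parts of a disconnected graph.
\<close>

lemma alpha_orientations_three_sparse:
  assumes "finite_simple_graph V E" "three_sparse V E"
  shows "real (card (alpha_orientations V E \<alpha>)) \<le> (7/2)^card V"
  using assms
proof (induction "card V" arbitrary: V E rule: less_induct)
  case less
  interpret finite_simple_graph V E by fact
  have fin: "finite V" by (rule finite_vertices)
  show ?case
  proof (cases "connected_graph V E \<and> V \<noteq> {}")
    case True
    let ?k = "card V - 1"
    have "E = induced E V" using edges unfolding induced_def by blast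
    then have "card E \<le> 3 * ?k"
      using less.prems(2) True unfolding three_sparse_def by (metis subset_refl)
    then have "(7/4::real)^card E \<le> (7/4)^(3 * ?k)" by (intro power_increasing) auto
    then have "real (card (alpha_orientations V E \<alpha>)) * (7/4)^(2 * ?k) \<le> 2^?k * (7/4)^(3 * ?k)"
      using alpha_orientations_connected[OF less.prems(1) _ less.prems(2)] True
      by (meson mult_left_mono order_trans zero_le_numeral zero_le_power)
    also have "\<dots> = (7/2)^?k * (7/4)^(2 * ?k)"
    proof -
      have "(2::real)^?k * (7/4)^?k = (7/2)^?k" by (simp flip: power_mult_distrib)
      moreover have "3 * ?k = ?k + 2 * ?k" by simp
      ultimately show ?thesis by (metis mult.assoc power_add)
    qed
    finally have "real (card (alpha_orientations V E \<alpha>)) \<le> (7/2)^?k" by simp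
    also have "\<dots> \<le> (7/2)^card V" by (intro power_increasing) auto
    finally show ?thesis .
  next
    case False
    show ?thesis
    proof (cases "V = {}")
      case True
      then have "E = {}" using no_edges by simp
      then show ?thesis using True alpha_orientations_edgeless[of V \<alpha>] by simp
    next
      case nonempty: False
      then obtain U where U: "U \<subseteq> V" "U \<noteq> {}" "U \<noteq> V"
        and cut: "\<And>u w. u \<in> U \<Longrightarrow> w \<in> V - U \<Longrightarrow> {u, w} \<notin> E"
        using False unfolding connected_graph_def by blast
      have less_V: "card U < card V" "card (V - U) < card V"
        using U fin by (auto intro!: psubset_card_mono)
      have "real (card (alpha_orientations V E \<alpha>)) \<le>
          real (card (alpha_orientations U (induced E U) \<alpha>)) * real (card (alpha_orientations (V - U) (induced E (V - U)) \<alpha>))"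
        using alpha_orientations_split[OF U(1) cut] by (metis of_nat_le_iff of_nat_mult)
      also have "\<dots> \<le> (7/2)^card U * (7/2)^card (V - U)"
        using less_V U(1) less.prems(2)
        by (intro mult_mono less.hyps graph_induced three_sparse_induced[OF less.prems(2)]) auto
      also have "\<dots> = (7/2)^card V"
        using U(1) fin by (metis card_Diff_subset card_mono finite_subset le_add_diff_inverse power_add)
      finally show ?thesis .
    qed
  qed
qed

section \<open>Arcs attached to a connected plane set\<close>

text \<open>
  An arc attached to a path connected set at both ends lies on a Jordan curve whose other half
  runs through that set.
\<close>

lemma chord_closes_to_Jordan_curve:
  fixes K :: "complex set"
  assumes "path_connected K" "arc e"
    and meet: "K \<inter> path_image e = {pathstart e, pathfinish e}"
  obtains P inner outer where "arc P" "path_image P \<subseteq> K"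
    "open inner" "connected inner" "open outer" "connected outer" "inner \<inter> outer = {}"
    "inner \<union> outer = - (path_image e \<union> path_image P)"
    "frontier inner = path_image e \<union> path_image P"
    "frontier outer = path_image e \<union> path_image P"
    "pathstart e \<in> path_image P" "pathfinish e \<in> path_image P"
proof -
  have ne: "pathfinish e \<noteq> pathstart e"
    using \<open>arc e\<close> arc_distinct_ends by metis
  obtain P where P: "arc P" "path_image P \<subseteq> K" "pathstart P = pathfinish e" "pathfinish P = pathstart e"
    using assms(1) ne meet unfolding path_connected_arcwise by (metis IntD1 insertCI)
  have "simple_path (e +++ P)"
    by (rule simple_path_join_loop) (use assms P in auto)
  then obtain inner outer where io: "open inner" "connected inner" "open outer" "connected outer"
      "inner \<inter> outer = {}" "inner \<union> outer = - path_image (e +++ P)"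
      "frontier inner = path_image (e +++ P)" "frontier outer = path_image (e +++ P)"
    by (rule Jordan_curve) (use P in auto)
  have "path_image (e +++ P) = path_image e \<union> path_image P"
    by (rule path_image_join) (use P in auto)
  moreover have "pathstart e \<in> path_image P" "pathfinish e \<in> path_image P"
    using P by (metis pathstart_in_path_image pathfinish_in_path_image)+
  ultimately show ?thesis using that[of P inner outer] P io by simp
qed

text \<open>
  Finite sets of points in pairwise different components of the complement of \<open>K\<close> take the place
  of a count of faces. In this way the number of components need not be known to be finite.
\<close>

definition separated :: "complex set \<Rightarrow> complex set \<Rightarrow> bool" where
  "separated K A \<longleftrightarrow> A \<inter> K = {} \<and> pairwise (\<lambda>a b. \<not> connected_component (- K) a b) A"

definition open_arc :: "(real \<Rightarrow> complex) \<Rightarrow> complex set" where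
  "open_arc e = path_image e - {pathstart e, pathfinish e}"

lemma connected_open_arc: "arc e \<Longrightarrow> connected (open_arc e)"
  unfolding open_arc_def by (rule connected_simple_path_endless) (rule arc_imp_simple_path)

lemma open_arc_nonempty: "arc e \<Longrightarrow> open_arc e \<noteq> {}"
  unfolding open_arc_def using nonempty_simple_path_endless arc_imp_simple_path by blast

lemma connected_component_mono_compl:
  "connected_component (- L) a b \<Longrightarrow> K \<subseteq> L \<Longrightarrow> connected_component (- K) a b"
  by (meson Compl_anti_mono connected_component_of_subset)

text \<open>
  Near any of its inner points \<open>x\<close>, the arc has points of the inside and of the outside of
  the Jordan curve, because \<open>x\<close> is in the frontier of both. They lie in the face \<open>W\<close> of \<open>K\<close> that contains \<open>x\<close>, so
  together they can replace the representative of \<open>W\<close>, if there is one.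
\<close>

lemma chord_adds_a_face:
  assumes K: "compact K" "path_connected K" and e: "arc e"
    and meet: "K \<inter> path_image e = {pathstart e, pathfinish e}"
    and A: "finite A" "separated K A"
  shows "\<exists>A'. finite A' \<and> separated (K \<union> path_image e) A' \<and> card A < card A'"
proof -
  obtain P inner outer where P: "arc P" "path_image P \<subseteq> K"
    "open inner" "connected inner" "open outer" "connected outer" "inner \<inter> outer = {}"
    "inner \<union> outer = - (path_image e \<union> path_image P)"
    "frontier inner = path_image e \<union> path_image P"
    "frontier outer = path_image e \<union> path_image P"
    using chord_closes_to_Jordan_curve[OF K(2) e meet] by metis
  obtain x where x: "x \<in> open_arc e" using open_arc_nonempty[OF e] by blast
  have arcK: "open_arc e \<subseteq> - K" using meet by (auto simp: open_arc_def)
  define W where "W = connected_component_set (- K) x"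
  have W: "open W" "W \<subseteq> - K"
    unfolding W_def using K(1) connected_component_subset
    by (simp_all add: open_connected_component compact_imp_closed open_Compl)
  have eW: "open_arc e \<subseteq> W"
    unfolding W_def using connected_component_maximal[OF x connected_open_arc[OF e] arcK] .
  have "x \<in> W" using eW x by blast
  have xC: "x \<in> closure inner" "x \<in> closure outer"
    using x P(9,10) unfolding frontier_def open_arc_def by blast+
  obtain a where a: "a \<in> W" "a \<in> inner"
    using xC(1) W(1) \<open>x \<in> W\<close> unfolding closure_iff_nhds_not_empty by blast
  obtain b where b: "b \<in> W" "b \<in> outer"
    using xC(2) W(1) \<open>x \<in> W\<close> unfolding closure_iff_nhds_not_empty by blast
  have ab: "\<not> connected_component (- (K \<union> path_image e)) a b"
  proof
    assume "connected_component (- (K \<union> path_image e)) a b"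
    then have "connected_component (inner \<union> outer) a b"
      unfolding P(8) by (rule connected_component_mono_compl) (use P(2) in blast)
    then obtain T where T: "connected T" "T \<subseteq> inner \<union> outer" "a \<in> T" "b \<in> T"
      unfolding connected_component_def by blast
    then show False
      using connectedD[OF T(1) P(3) P(5)] P(7) a b by blast
  qed
  define B where "B = A - W"
  have "card A \<le> card B + 1"
  proof -
    have "card (A \<inter> W) \<le> 1"
    proof (rule ccontr)
      assume "\<not> card (A \<inter> W) \<le> 1"
      then obtain c d where "c \<in> A \<inter> W" "d \<in> A \<inter> W" "c \<noteq> d"
        using A(1) by (metis card_le_Suc0_iff_eq finite_Int One_nat_def)
      then have "connected_component (- K) c d" unfolding W_def
        by (auto intro: connected_component_trans connected_component_sym)
      then show False using A(2) \<open>c \<in> A \<inter> W\<close> \<open>d \<in> A \<inter> W\<close> \<open>c \<noteq> d\<close>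
        unfolding separated_def pairwise_def by blast
    qed
    moreover have "card A \<le> card (A \<inter> W) + card B"
      using card_Un_le[of "A \<inter> W" B] unfolding B_def by (simp add: Int_Diff_Un)
    ultimately show ?thesis by linarith
  qed
  moreover have "a \<notin> B" "b \<notin> B" "a \<noteq> b" using a b P(7) unfolding B_def by auto
  ultimately have card: "card A < card (insert a (insert b B))"
    using A(1) unfolding B_def by simp
  have WB: "\<not> connected_component (- K) w c" "\<not> connected_component (- K) c w"
    if "w \<in> W" "c \<in> B" for w c
    using that unfolding W_def B_def
    by (auto intro: connected_component_trans connected_component_sym)
  have mono: "\<not> connected_component (- (K \<union> path_image e)) c d"
    if "\<not> connected_component (- K) c d" for c d
    using connected_component_mono_compl that by blast
  have sep: "separated (K \<union> path_image e) (insert a (insert b B))"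
    unfolding separated_def
  proof
    have "B \<inter> path_image e = {}"
      using eW A(2) meet unfolding B_def separated_def open_arc_def by blast
    moreover have "B \<inter> K = {}" using A(2) unfolding B_def separated_def by blast
    moreover have "a \<notin> path_image e" "b \<notin> path_image e" using a b P(8) by blast+
    moreover have "a \<notin> K" "b \<notin> K" using a b W by blast+
    ultimately show "insert a (insert b B) \<inter> (K \<union> path_image e) = {}" by blast
  next
    have "pairwise (\<lambda>a b. \<not> connected_component (- (K \<union> path_image e)) a b) B"
      using A(2) mono unfolding separated_def B_def pairwise_def by blast
    then show "pairwise (\<lambda>a b. \<not> connected_component (- (K \<union> path_image e)) a b) (insert a (insert b B))"
      using ab mono WB a(1) b(1) connected_component_sym
      unfolding pairwise_insert by blast
  qed
  show ?thesis
    by (intro exI[of _ "insert a (insert b B)"]) (use sep card A(1) B_def in auto)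
qed

text \<open>
  Of three points, two are on the same side of the Jordan curve that closes up the arc. This
  curve meets \<open>K\<close> in an arc, a connected set, so Janiszewski's theorem applies: as neither
  \<open>K\<close> nor the curve separates the two points, their union does not either.
\<close>

lemma chord_splits_face_in_two:
  assumes K: "compact K" "path_connected K" and e: "arc e"
    and meet: "K \<inter> path_image e = {pathstart e, pathfinish e}"
    and A: "finite A" "separated (K \<union> path_image e) A"
    and W: "\<And>a b. a \<in> A \<Longrightarrow> b \<in> A \<Longrightarrow> connected_component (- K) a b"
  shows "card A \<le> 2"
proof (rule ccontr)
  assume "\<not> card A \<le> 2"
  then have "3 \<le> card A" by simp
  then obtain B where "B \<subseteq> A" "card B = 3" by (metis obtain_subset_with_card_n)
  then obtain a b c where abc: "a \<in> A" "b \<in> A" "c \<in> A" "a \<noteq> b" "b \<noteq> c" "a \<noteq> c"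
    unfolding card_3_iff by blast
  obtain P inner outer where P: "arc P" "path_image P \<subseteq> K"
    "open inner" "connected inner" "open outer" "connected outer" "inner \<inter> outer = {}"
    "inner \<union> outer = - (path_image e \<union> path_image P)"
    and ends: "pathstart e \<in> path_image P" "pathfinish e \<in> path_image P"
    using chord_closes_to_Jordan_curve[OF K(2) e meet] by metis
  have "A \<inter> (path_image e \<union> path_image P) = {}"
    using A(2) P(2) unfolding separated_def by blast
  then have "A \<subseteq> inner \<union> outer" unfolding P(8) by blast
  then have "a \<in> inner \<or> a \<in> outer" "b \<in> inner \<or> b \<in> outer" "c \<in> inner \<or> c \<in> outer"
    using abc by auto
  then obtain u v X where uv: "u \<in> A" "v \<in> A" "u \<noteq> v" "u \<in> X" "v \<in> X"
     and X: "X = inner \<or> X = outer"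
    using abc by metis
  have "connected X" "X \<subseteq> - (path_image e \<union> path_image P)" using X P by auto
  then have "connected_component (- (path_image e \<union> path_image P)) u v"
    using uv unfolding connected_component_def by blast
  moreover have "K \<inter> (path_image e \<union> path_image P) = path_image P"
    using P(2) ends by (auto simp: Int_Un_distrib meet)
  moreover have "closed (path_image e \<union> path_image P)"
    using e P(1) by (simp add: closed_Un closed_arc_image)
  ultimately have "connected_component (- (K \<union> (path_image e \<union> path_image P))) u v"
    by (intro Janiszewski[OF K(1)]) (use W[OF uv(1,2)] connected_arc_image[OF P(1)] in \<open>simp_all only:\<close>)
  moreover have "K \<union> (path_image e \<union> path_image P) = K \<union> path_image e" using P(2) by blast
  ultimately show False using A(2) uv unfolding separated_def pairwise_def by metis
qed

text \<open>
  All faces that have an inner point of the arc in their frontier come from the one face of \<open>K\<close>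
  that contains the open arc.
\<close>

lemma edge_borders_two_faces:
  assumes K: "compact K" "path_connected K" and e: "arc e"
    and meet: "K \<inter> path_image e = {pathstart e, pathfinish e}"
    and A: "finite A" "separated (K \<union> path_image e) A"
  shows "card {a \<in> A. frontier (connected_component_set (- (K \<union> path_image e)) a) \<inter> open_arc e \<noteq> {}} \<le> 2"
    (is "card ?B \<le> 2")
proof (rule chord_splits_face_in_two[OF K e meet])
  show "finite ?B" using A by simp
  show "separated (K \<union> path_image e) ?B"
    using A(2) unfolding separated_def pairwise_def by blast
  obtain x where x: "x \<in> open_arc e" using open_arc_nonempty[OF e] by blast
  have arcK: "open_arc e \<subseteq> - K" using meet by (auto simp: open_arc_def)
  define W where "W = connected_component_set (- K) x"
  have W: "open W" unfolding W_def using K(1)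
    by (simp add: open_connected_component compact_imp_closed open_Compl)
  have eW: "open_arc e \<subseteq> W"
    unfolding W_def using connected_component_maximal[OF x connected_open_arc[OF e] arcK] .
  have "connected_component (- K) x a" if "a \<in> ?B" for a
  proof -
    obtain y where "y \<in> W" "y \<in> closure (connected_component_set (- (K \<union> path_image e)) a)"
      using \<open>a \<in> ?B\<close> eW unfolding frontier_def by blast
    then obtain z where z: "z \<in> W" "connected_component (- (K \<union> path_image e)) a z"
      using W unfolding closure_iff_nhds_not_empty by blast
    then have "connected_component (- K) a z"
      by (metis connected_component_mono_compl Un_upper1)
    then show ?thesis using z(1) unfolding W_def
      by (auto intro: connected_component_trans connected_component_sym)
  qed
  then show "connected_component (- K) a b" if "a \<in> ?B" "b \<in> ?B" for a b
    using that by (meson connected_component_sym connected_component_trans)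
qed

text \<open>
  The face \<open>U\<close> of \<open>K\<close> at \<open>a\<close> has no frontier point in the connected set \<open>- L\<close>, so it contains all of
  it; but it is disjoint from \<open>K\<close>.
\<close>

lemma face_with_nonseparating_frontier:
  fixes K L :: "complex set"
  assumes K: "closed K" and "L \<subseteq> K" "a \<notin> K" "connected (- L)"
    and fr: "frontier (connected_component_set (- K) a) \<subseteq> L"
  shows "K = L"
proof -
  define U where "U = connected_component_set (- K) a"
  have U: "U \<subseteq> - K" "a \<in> U"
    unfolding U_def using \<open>a \<notin> K\<close> by (simp_all add: connected_component_subset)
  have "- L \<subseteq> U"
  proof (rule ccontr)
    assume "\<not> - L \<subseteq> U"
    then have "- L \<inter> frontier U \<noteq> {}"
      using U \<open>L \<subseteq> K\<close> by (intro connected_Int_frontier[OF \<open>connected (- L)\<close>]) auto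
    then show False using fr U_def by blast
  qed
  then show ?thesis using U \<open>L \<subseteq> K\<close> by blast
qed

section \<open>The number of edges of a planar map\<close>

context planar_map
begin

definition drawing :: "'a set set \<Rightarrow> complex set" where
  "drawing F = pos ` V \<union> (\<Union>e\<in>F. path_image (\<gamma> e))"

lemma drawing_insert: "drawing (insert e F) = drawing F \<union> path_image (\<gamma> e)"
  unfolding drawing_def by blast

lemma compact_drawing: "F \<subseteq> E \<Longrightarrow> compact (drawing F)"
  unfolding drawing_def using finite_vertices finite_edges finite_subset[of F E]
  by (intro compact_Un compact_UN compact_arc_image edge_arc finite_imp_compact) auto

lemma drawing_Int_edge:
  assumes "e \<in> E" "F \<subseteq> E" "e \<notin> F"
  shows "drawing F \<inter> path_image (\<gamma> e) = {pathstart (\<gamma> e), pathfinish (\<gamma> e)}"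
proof -
  have "path_image (\<gamma> f) \<inter> path_image (\<gamma> e) \<subseteq> pos ` e" if "f \<in> F" for f
    using crossing_free[of f e] assms that by blast
  moreover have "pos ` e \<subseteq> pos ` V" using edges[OF assms(1)] by blast
  ultimately show ?thesis
    using edge_avoids_vertices[OF assms(1)] unfolding edge_ends[OF assms(1)] drawing_def by blast
qed

lemma open_arc_edge: "e \<in> E \<Longrightarrow> open_arc (\<gamma> e) = path_image (\<gamma> e) - pos ` e"
  unfolding open_arc_def by (simp add: edge_ends)

lemma drawing_absorbs_only_drawn_edges:
  assumes "e \<in> E" "F \<subseteq> E" "path_image (\<gamma> e) \<subseteq> drawing F"
  shows "e \<in> F"
  using drawing_Int_edge[OF assms(1,2)] assms(3) open_arc_nonempty[OF edge_arc[OF assms(1)]]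
  unfolding open_arc_def by blast

text \<open>
  Consider the vertices drawn in the path component of one vertex. If there were others, an edge
  of the graph would lead to one of them, and its arc would be a path out of that component.
\<close>

lemma path_connected_drawing:
  assumes F: "F \<subseteq> E" and conn: "connected_graph V F" and "V \<noteq> {}"
  shows "path_connected (drawing F)"
proof -
  obtain v0 where v0: "v0 \<in> V" using assms(3) by blast
  define R where "R = path_component_set (drawing F) (pos v0)"
  have posD: "pos v \<in> drawing F" if "v \<in> V" for v using that unfolding drawing_def by blast
  have edgeR: "path_image (\<gamma> e) \<subseteq> R" if e: "e \<in> F" "u \<in> e" "pos u \<in> R" for e u
  proof -
    have "pos u \<in> path_image (\<gamma> e)" using edge_avoids_vertices[of e] e F by blast
    moreover have "path_connected (path_image (\<gamma> e))"
      using edge_arc[of e] e F by (intro path_connected_path_image arc_imp_path) auto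
    moreover have "path_image (\<gamma> e) \<subseteq> drawing F" using e unfolding drawing_def by blast
    ultimately have "path_image (\<gamma> e) \<subseteq> path_component_set (drawing F) (pos u)"
      by (intro path_component_maximal) auto
    also have "\<dots> = R" using e(3) unfolding R_def by (metis mem_Collect_eq path_component_eq)
    finally show ?thesis .
  qed
  define U where "U = {v \<in> V. pos v \<in> R}"
  have "U = V"
  proof (rule ccontr)
    assume "U \<noteq> V"
    moreover have "v0 \<in> U" using v0 posD unfolding U_def R_def by (simp add: path_component_refl)
    ultimately obtain u w where uw: "u \<in> U" "w \<in> V - U" "{u, w} \<in> F"
      using connected_graphD[OF conn, of U] unfolding U_def by blast
    have "pos w \<in> path_image (\<gamma> {u, w})" using edge_avoids_vertices[of "{u, w}"] uw F by blast
    then have "pos w \<in> R" using edgeR[OF uw(3), of u] uw(1) unfolding U_def by blast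
    then show False using uw(2) unfolding U_def by blast
  qed
  then have vR: "pos ` V \<subseteq> R" unfolding U_def by blast
  have "path_image (\<gamma> e) \<subseteq> R" if "e \<in> F" for e
  proof -
    obtain a b where "e = {a, b}" "a \<in> V" using edge_as_pair[of e] F \<open>e \<in> F\<close> by blast
    then show ?thesis using edgeR[OF that, of a] vR by blast
  qed
  then have "drawing F \<subseteq> R" unfolding drawing_def using vR by blast
  then have "R = drawing F" unfolding R_def using path_component_subset by blast
  then show ?thesis
    using path_connected_path_component[of "drawing F" "pos v0"] unfolding R_def by simp
qed

text \<open>
  The lower half of Euler's formula. The drawing of a spanning tree has at least one face, and
  each further edge is a chord of a path connected drawing, so it adds one.
\<close>

lemma many_faces:
  assumes conn: "connected_graph V E" and "V \<noteq> {}"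
  obtains A where "finite A" "separated (drawing E) A" "card E + 2 \<le> card A + card V"
proof -
  obtain T where T: "T \<subseteq> E" "finite T" "card T < card V" "connected_graph V T"
    using spanning_tree[OF finite_vertices assms(2) conn] by metis
  have "\<exists>A. finite A \<and> separated (drawing (T \<union> X)) A \<and> card (T \<union> X) + 2 \<le> card A + card V"
    if "finite X" "X \<subseteq> E - T" for X
    using that
  proof (induction X rule: finite_induct)
    case empty
    have "drawing T \<noteq> UNIV" using compact_drawing[OF T(1)] by (metis not_compact_UNIV)
    then obtain a where "a \<notin> drawing T" by blast
    then show ?case using T(3) by (intro exI[of _ "{a}"]) (auto simp: separated_def)
  next
    case (insert e X)
    then obtain A where A: "finite A" "separated (drawing (T \<union> X)) A" "card (T \<union> X) + 2 \<le> card A + card V"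
      by auto
    have e: "e \<in> E" "e \<notin> T \<union> X" and TX: "T \<union> X \<subseteq> E" using insert T by auto
    have "path_connected (drawing (T \<union> X))"
      using connected_graph_mono[OF T(4)] by (intro path_connected_drawing TX assms(2)) auto
    then obtain A' where A': "finite A'" "separated (drawing (T \<union> X) \<union> path_image (\<gamma> e)) A'" "card A < card A'"
      using chord_adds_a_face[OF compact_drawing[OF TX] _ edge_arc[OF e(1)] drawing_Int_edge[OF e(1) TX e(2)] A(1,2)]
      by blast
    have "T \<union> insert e X = insert e (T \<union> X)" by blast
    then have "separated (drawing (T \<union> insert e X)) A'" using A'(2) by (simp add: drawing_insert)
    moreover have "card (T \<union> insert e X) = Suc (card (T \<union> X))"
      using e(2) T(2) insert.hyps(1) by simp
    ultimately show ?case using A' A(3) by (intro exI[of _ A']) auto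
  qed
  from this[of "E - T"] show ?thesis using that T(1) finite_edges by (auto simp: Un_absorb1)
qed

text \<open>
  This is where simplicity of the graph matters: two distinct edges share at most one end point, so
  Janiszewski's theorem applies to the two arcs. Removing finitely many isolated points from
  a connected open set is harmless.
\<close>

lemma connected_compl_two_edges:
  assumes "F \<subseteq> E" "card F \<le> 2"
  shows "connected (- drawing F)"
proof -
  define L where "L = (\<Union>e\<in>F. path_image (\<gamma> e))"
  have arc1: "connected (- path_image (\<gamma> e))" if "e \<in> E" for e
    by (rule connected_arc_complement[OF edge_arc[OF that]]) simp
  have finF: "finite F" using assms(1) finite_edges finite_subset by blast
  consider "F = {}" | e where "F = {e}" | e f where "F = {e, f}" "e \<noteq> f"
    using assms(2) finF by (metis card_0_eq card_1_singletonE card_2_iff le_Suc_eq le_zero_eq numeral_2_eq_2 One_nat_def)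
  then have "connected (- L)"
  proof cases
    case (3 e f)
    then have ef: "e \<in> E" "f \<in> E" using assms(1) by auto
    have "card (e \<inter> f) \<le> 1"
    proof (rule ccontr)
      assume *: "\<not> card (e \<inter> f) \<le> 1"
      have fin: "finite e" "finite f" and c: "card e = 2" "card f = 2"
        using edges ef by (auto intro: card_ge_0_finite)
      have "e \<inter> f = e" by (rule card_subset_eq) (use fin c * card_mono[of e "e \<inter> f"] in auto)
      moreover have "e \<inter> f = f" by (rule card_subset_eq) (use fin c * card_mono[of f "e \<inter> f"] in auto)
      ultimately show False using 3(2) by blast
    qed
    moreover have "finite (e \<inter> f)" using edges ef finite_vertices by (meson finite_Int finite_subset)
    ultimately obtain x where "e \<inter> f \<subseteq> {x}" by (metis card_le_Suc0_iff_eq One_nat_def subsetI singleton_iff empty_subsetI equals0I)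
    then have "path_image (\<gamma> e) \<inter> path_image (\<gamma> f) \<subseteq> {pos x}" using crossing_free[OF ef 3(2)] by blast
    then have "path_image (\<gamma> e) \<inter> path_image (\<gamma> f) = {} \<or> path_image (\<gamma> e) \<inter> path_image (\<gamma> f) = {pos x}" by blast
    then have "connected (path_image (\<gamma> e) \<inter> path_image (\<gamma> f))" by auto
    then have "connected (- (path_image (\<gamma> e) \<union> path_image (\<gamma> f)))"
      using ef edge_arc arc1 by (intro Janiszewski_connected compact_arc_image closed_arc_image)
    then show ?thesis unfolding L_def 3 by simp
  qed (use assms(1) arc1 in \<open>auto simp: L_def\<close>)
  moreover have "open (- L)"
    unfolding L_def using finF assms(1) edge_arc by (auto intro!: closed_UN closed_arc_image)
  ultimately have "connected (- L - pos ` V)"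
    by (intro connected_open_delete_finite) (use finite_vertices in auto)
  moreover have "- L - pos ` V = - drawing F" unfolding L_def drawing_def by blast
  ultimately show ?thesis by simp
qed

definition face :: "complex \<Rightarrow> complex set" where
  "face a = connected_component_set (- drawing E) a"

text \<open>
  The frontier of a face lies in the drawing of the edges that the face borders. If these were
  at most two, their drawing would not separate the plane, so it would be the entire drawing.
\<close>

lemma face_borders_three_edges:
  assumes a: "a \<notin> drawing E" and many: "card E \<ge> 3"
  shows "card {e \<in> E. frontier (face a) \<inter> open_arc (\<gamma> e) \<noteq> {}} \<ge> 3" (is "card ?S \<ge> 3")
proof (rule ccontr)
  assume "\<not> card ?S \<ge> 3"
  then have conn: "connected (- drawing ?S)" by (intro connected_compl_two_edges) auto
  have clo: "closed (drawing E)" using compact_drawing[of E] compact_imp_closed by blast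
  have "frontier (face a) \<subseteq> frontier (- drawing E)"
    unfolding face_def by (rule frontier_of_connected_component_subset)
  also have "\<dots> \<subseteq> drawing E" using clo by (simp add: frontier_subset_closed)
  finally have "frontier (face a) \<subseteq> drawing E" .
  moreover have "x \<in> drawing ?S" if x: "x \<in> frontier (face a)" "x \<in> path_image (\<gamma> e)" "e \<in> E" for x e
  proof (cases "x \<in> pos ` e")
    case True
    then show ?thesis using edges[OF x(3)] unfolding drawing_def by blast
  next
    case False
    then have "e \<in> ?S" using x by (auto simp: open_arc_edge)
    then show ?thesis using x unfolding drawing_def by blast
  qed
  ultimately have "frontier (face a) \<subseteq> drawing ?S" unfolding drawing_def by blast
  then have eq: "drawing E = drawing ?S"
    using a clo conn unfolding face_def
    by (intro face_with_nonseparating_frontier) (auto simp: drawing_def)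
  have "e \<in> ?S" if "e \<in> E" for e
  proof (rule drawing_absorbs_only_drawn_edges[OF that])
    have "path_image (\<gamma> e) \<subseteq> drawing E"
      unfolding drawing_def using that by blast
    then show "path_image (\<gamma> e) \<subseteq> drawing ?S" by (simp only: eq)
  qed simp
  then have "?S = E" by blast
  then show False using many \<open>\<not> card ?S \<ge> 3\<close> by simp
qed

text \<open>
  Count the pairs of a face and an edge on its frontier: at least three for each face, at most
  two for each edge. With at least \<open>card E - card V + 2\<close> faces this gives \<open>card E \<le> 3 * card V - 6\<close>.
\<close>

lemma edge_bound_of_bridgeless:
  assumes conn: "\<And>e. e \<in> E \<Longrightarrow> connected_graph V (E - {e})" and many: "card E \<ge> 3"
  shows "card E \<le> 3 * (card V - 1)"
proof -
  obtain e0 where e0: "e0 \<in> E" using many by fastforce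
  then have V: "V \<noteq> {}" and connE: "connected_graph V E"
    using edge_as_pair connected_graph_mono[OF conn[OF e0]] by (metis empty_iff, blast)
  obtain A where A: "finite A" "separated (drawing E) A" "card E + 2 \<le> card A + card V"
    using many_faces[OF connE V] by metis
  define inc where "inc a e \<longleftrightarrow> frontier (face a) \<inter> open_arc (\<gamma> e) \<noteq> {}" for a e
  have "3 * card A = (\<Sum>a\<in>A. 3)" by simp
  also have "\<dots> \<le> (\<Sum>a\<in>A. card {e \<in> E. inc a e})"
    using face_borders_three_edges[OF _ many] A(2) unfolding inc_def separated_def
    by (intro sum_mono) blast
  also have "\<dots> = (\<Sum>e\<in>E. card {a \<in> A. inc a e})"
    by (rule sum_multicount_gen[symmetric]) (use A finite_edges in auto)
  also have "\<dots> \<le> (\<Sum>e\<in>E. 2)"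
  proof (rule sum_mono)
    fix e assume e: "e \<in> E"
    have D: "drawing (E - {e}) \<union> path_image (\<gamma> e) = drawing E"
      using drawing_insert[of e "E - {e}"] e by (simp add: insert_absorb)
    have "compact (drawing (E - {e}))" "path_connected (drawing (E - {e}))"
      by (rule compact_drawing path_connected_drawing; use V conn[OF e] in blast)+
    moreover have "drawing (E - {e}) \<inter> path_image (\<gamma> e) = {pathstart (\<gamma> e), pathfinish (\<gamma> e)}"
      by (rule drawing_Int_edge[OF e]) auto
    ultimately have "card {a \<in> A. frontier (connected_component_set (- (drawing (E - {e}) \<union> path_image (\<gamma> e))) a)
        \<inter> open_arc (\<gamma> e) \<noteq> {}} \<le> 2"
      using A(2) unfolding D[symmetric] by (intro edge_borders_two_faces edge_arc[OF e] A(1))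
    then show "card {a \<in> A. inc a e} \<le> 2" unfolding D inc_def face_def .
  qed
  finally have "3 * card A \<le> 2 * card E" by simp
  then show ?thesis using A(3) V finite_vertices by simp
qed

end

lemma planar_map_induced:
  assumes "planar_map V E pos \<gamma>" "U \<subseteq> V"
  shows "planar_map U (induced E U) pos \<gamma>"
proof -
  interpret planar_map V E pos \<gamma> by fact
  interpret U: finite_simple_graph U "induced E U" by (rule graph_induced[OF assms(2)])
  have ind: "e \<in> E" "e \<subseteq> U" if "e \<in> induced E U" for e using that unfolding induced_def by auto
  show ?thesis
  proof unfold_locales
    fix e assume e: "e \<in> induced E U"
    then have "pos ` e \<subseteq> pos ` U" using ind by blast
    then show "path_image (\<gamma> e) \<inter> pos ` U = pos ` e"
      using edge_avoids_vertices[OF ind(1)[OF e]] assms(2) by blast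
  qed (use ind edge_arc edge_ends crossing_free inj_on_subset[OF inj_pos assms(2)] in auto)
qed

text \<open>
  A cut crossed by at most three edges splits the claim into the claims for its two sides. If every
  cut is crossed by at least four, the graph stays connected after the deletion of any edge, so the
  face count applies.
\<close>

lemma planar_edge_bound:
  assumes "planar_map V E pos \<gamma>" "V \<noteq> {}"
  shows "card E \<le> 3 * (card V - 1)"
  using assms
proof (induction "card V" arbitrary: V E rule: less_induct)
  case less
  interpret planar_map V E pos \<gamma> by fact
  define crossing where "crossing U = {e \<in> E. \<not> e \<subseteq> U \<and> \<not> e \<subseteq> V - U}" for U
  show ?case
  proof (cases "\<exists>U. U \<subseteq> V \<and> U \<noteq> {} \<and> U \<noteq> V \<and> card (crossing U) \<le> 3")
    case True
    then obtain U where U: "U \<subseteq> V" "U \<noteq> {}" "U \<noteq> V" "card (crossing U) \<le> 3" by blast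
    have less_V: "card U < card V" "card (V - U) < card V"
      using U finite_vertices by (auto intro!: psubset_card_mono)
    have "E = induced E U \<union> induced E (V - U) \<union> crossing U"
      unfolding induced_def crossing_def by blast
    then have "card E \<le> card (induced E U) + card (induced E (V - U)) + card (crossing U)"
      by (metis card_Un_le add_le_mono1 order_trans)
    also have "\<dots> \<le> 3 * (card U - 1) + 3 * (card (V - U) - 1) + 3"
      using less_V U planar_map_induced[OF less.prems(1)] less.hyps
      by (intro add_mono) (auto simp: Diff_eq_empty_iff)
    also have "\<dots> = 3 * (card V - 1)"
    proof -
      have "card V = card U + card (V - U)"
        using U(1) finite_vertices by (metis card_Diff_subset card_mono finite_subset le_add_diff_inverse)
      moreover have "card U \<ge> 1" "card (V - U) \<ge> 1"
        using U finite_vertices finite_subset[OF U(1)] by (auto simp: Suc_le_eq card_gt_0_iff)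
      ultimately show ?thesis by simp
    qed
    finally show ?thesis .
  next
    case False
    have four: "card (crossing U) > 3" if "U \<subseteq> V" "U \<noteq> {}" "U \<noteq> V" for U
      using False that not_le by blast
    have conn: "connected_graph V (E - {e})" for e
      unfolding connected_graph_def
    proof (intro allI impI)
      fix U assume U: "U \<subseteq> V" "U \<noteq> {}" "U \<noteq> V"
      have "\<not> crossing U \<subseteq> {e}"
      proof
        assume "crossing U \<subseteq> {e}"
        then have "card (crossing U) \<le> 1" using card_mono[of "{e}" "crossing U"] by simp
        then show False using four[OF U] by simp
      qed
      then obtain f where f: "f \<in> E" "f \<noteq> e" "\<not> f \<subseteq> U" "\<not> f \<subseteq> V - U"
        unfolding crossing_def by blast
      obtain a b where ab: "f = {a, b}" "a \<in> V" "b \<in> V" using edge_as_pair[OF f(1)] by metis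
      have in_E: "{a, b} \<in> E - {e}" "{b, a} \<in> E - {e}" using f ab by (auto simp: insert_commute)
      have "a \<in> U \<and> b \<in> V - U \<or> b \<in> U \<and> a \<in> V - U" using f ab by auto
      then show "\<exists>u\<in>U. \<exists>w\<in>V - U. {u, w} \<in> E - {e}" using in_E by blast
    qed
    show ?thesis
    proof (cases "card V \<ge> 2")
      case True
      then show ?thesis
        using edge_bound_of_bridgeless[OF conn] by (cases "card E \<ge> 3") auto
    next
      case False
      then have "E = {}" using no_edges by simp
      then show ?thesis by simp
    qed
  qed
qed

lemma planar_three_sparse:
  assumes "planar_map V E pos \<gamma>"
  shows "three_sparse V E"
  using planar_edge_bound planar_map_induced[OF assms] unfolding three_sparse_def by blast

section \<open>The bound for planar maps\<close>

theorem corollary1: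
  fixes V :: "'a set" and E :: "'a set set"
    and pos :: "'a \<Rightarrow> complex" and \<gamma> :: "'a set \<Rightarrow> real \<Rightarrow> complex"
    and \<alpha> :: "'a \<Rightarrow> nat" and n :: nat
  assumes "planar_map V E pos \<gamma>"
    and "card V = n"
  shows "real (card (alpha_orientations V E \<alpha>)) \<le> 3.73 ^ n"
proof -
  interpret planar_map V E pos \<gamma> by fact
  have "real (card (alpha_orientations V E \<alpha>)) \<le> (7/2) ^ n"
    using alpha_orientations_three_sparse[OF finite_simple_graph_axioms planar_three_sparse[OF assms(1)]]
      assms(2) by simp
  also have "\<dots> \<le> 3.73 ^ n" by (rule power_mono) auto
  finally show ?thesis .
qed

end
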